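(* Let $m,p,n\ge 1$ be integers with $p\mid m$ and $n\ge 5$. Then there are no nice $n$-tuples in the imprimitive complex reflection group $G(m,p,n)$.
   Context: $G(m,p,n)$ (with $p\mid m$) is the group of $n\times n$ complex generalized permutation matrices (exactly one nonzero entry in each row and each column) whose nonzero entries are $m$-th roots of unity and such that the product of all nonzero entries is an $(m/p)$-th root of unity. A reflection is an invertible matrix of finite order having exactly one eigenvalue different from $1$, of multiplicity $1$ (pseudo-reflections are allowed; the nontrivial eigenvalue may be any root of unity $\neq 1$). A $T$-tuple $[A_1,\dots,A_T]$ of matrices in a finite complex reflection group $W\subset \mathrm{GL}_n(\mathbb C)$ (considered up to simultaneous conjugation) is called nice if: (1) every $A_i$ is a reflection in $W$; (2) $W=\langle A_1,\dots,A_T\rangle$; (3) $(A_1A_2\cdots A_T)^{-1}$ has an eigenvalue $\lambda\neq 1$ of multiplicity $T-2$. *)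

theory Defs
  imports
    "HOL-Algebra.Generated_Groups"
    "Jordan_Normal_Form.Char_Poly"
begin

definition GL :: "nat \<Rightarrow> complex mat monoid" where
  "GL n = units_of (ring_mat TYPE(complex) n ())"

text \<open>
  Throughout, the multiplicity of an eigenvalue is its algebraic multiplicity, i.e. its order
  as a root of the characteristic polynomial. All matrices concerned have finite order, hence
  are diagonalizable, so this agrees with the dimension of the eigenspace.
\<close>

definition eigenvalue_mult :: "complex mat \<Rightarrow> complex \<Rightarrow> nat" where
  "eigenvalue_mult A a = Polynomial.order a (char_poly A)"

definition is_reflection :: "nat \<Rightarrow> complex mat \<Rightarrow> bool" where
  "is_reflection n A \<longleftrightarrow>
     A \<in> carrier (GL n) \<and>
     (\<exists>k>0. A ^\<^sub>m k = 1\<^sub>m n) \<and>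
     (\<exists>a. {b. eigenvalue A b \<and> b \<noteq> 1} = {a} \<and> eigenvalue_mult A a = 1)"

definition generalized_permutation_mat :: "nat \<Rightarrow> complex mat \<Rightarrow> bool" where
  "generalized_permutation_mat n A \<longleftrightarrow>
     A \<in> carrier_mat n n \<and>
     (\<forall>i<n. \<exists>!j. j < n \<and> A $$ (i, j) \<noteq> 0) \<and>
     (\<forall>j<n. \<exists>!i. i < n \<and> A $$ (i, j) \<noteq> 0)"

text \<open>The underlying set of \<open>G(m,p,n)\<close>; it is meaningful for \<open>p dvd m\<close>.\<close>

definition Gmpn :: "nat \<Rightarrow> nat \<Rightarrow> nat \<Rightarrow> complex mat set" where
  "Gmpn m p n =
     {A. generalized_permutation_mat n A \<and>
         (\<forall>i<n. \<forall>j<n. A $$ (i, j) \<noteq> 0 \<longrightarrow> A $$ (i, j) ^ m = 1) \<and>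
         (\<Prod>(i, j) \<in> {(i, j). i < n \<and> j < n \<and> A $$ (i, j) \<noteq> 0}. A $$ (i, j)) ^ (m div p) = 1}"

text \<open>
  A tuple \<open>[A\<^sub>1, \<dots>, A\<^sub>T]\<close> is a list of length \<open>T\<close>. Niceness is invariant under simultaneous
  conjugation of the tuple and the group, so it is stated for representatives. The multiplicity
  condition is written additively because subtraction of natural numbers truncates.
\<close>

definition nice_tuple :: "nat \<Rightarrow> complex mat set \<Rightarrow> complex mat list \<Rightarrow> bool" where
  "nice_tuple n W As \<longleftrightarrow>
     (\<forall>A\<in>set As. A \<in> W \<and> is_reflection n A) \<and>
     W = generate (GL n) (set As) \<and>
     (\<exists>a. a \<noteq> 1 \<and>
          eigenvalue (inv\<^bsub>GL n\<^esub> (foldr (*) As (1\<^sub>m n))) a \<and>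
          eigenvalue_mult (inv\<^bsub>GL n\<^esub> (foldr (*) As (1\<^sub>m n))) a + 2 = length As)"

end

theory Submission
  imports
    Defs
    "Jordan_Normal_Form.Jordan_Normal_Form_Existence"
    "HOL-Algebra.Multiplicative_Group"
    "HOL-Combinatorics.Cycles"
begin

text \<open>
  A monomial matrix of finite order is diagonalizable, and an eigenvector is determined by its
  entries on one representative of each cycle of the underlying permutation; so every eigenvalue
  multiplicity is at most the number of cycles. Applied to a reflection, whose eigenvalue
  \<open>1\<close> has multiplicity \<open>n - 1\<close>, this shows that its permutation is the
  identity or a transposition. If \<open>n\<close> reflections generate \<open>G(m,p,n)\<close>, these
  transpositions are the edges of a connected graph on \<open>n\<close> vertices, and a product of
  \<open>k\<close> transpositions whose graph has \<open>c\<close> components has at most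
  \<open>2 c + k - n\<close> cycles (the inequality genus \<open>\<ge> 0\<close> of Riemann-Hurwitz). With
  \<open>k = n\<close> and \<open>c = 1\<close> this leaves at most two cycles, fewer than the required
  multiplicity \<open>n - 2 \<ge> 3\<close>.
\<close>

section \<open>Cycles of products of transpositions\<close>

text \<open>For a permutation of a finite set, the smallest such \<open>R\<close> has one point in
  each cycle. Only upper bounds on the number of cycles matter, so any small \<open>R\<close> will
  do.\<close>

definition hits :: "'a set \<Rightarrow> ('a \<Rightarrow> 'a) \<Rightarrow> 'a set \<Rightarrow> bool" where
  "hits S f R \<longleftrightarrow> R \<subseteq> S \<and> (\<forall>i\<in>S. \<exists>r\<in>R. \<exists>k. (f ^^ k) r = i)"

definition forward_orbit :: "('a \<Rightarrow> 'a) \<Rightarrow> 'a \<Rightarrow> 'a set" where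
  "forward_orbit f x = range (\<lambda>k. (f ^^ k) x)"

lemma forward_orbit_self: "x \<in> forward_orbit f x"
  unfolding forward_orbit_def by (metis funpow_0 rangeI)

lemma forward_orbit_step: "y \<in> forward_orbit f x \<Longrightarrow> f y \<in> forward_orbit f x"
proof -
  assume "y \<in> forward_orbit f x"
  then obtain k where "y = (f ^^ k) x" by (auto simp: forward_orbit_def)
  then have "f y = (f ^^ Suc k) x" by simp
  then show ?thesis unfolding forward_orbit_def by (rule range_eqI)
qed

lemma forward_orbit_induct [consumes 1, case_names self step]:
  assumes "y \<in> forward_orbit f x" "P x" "\<And>y. y \<in> forward_orbit f x \<Longrightarrow> P y \<Longrightarrow> P (f y)"
  shows "P y"
proof -
  have "P ((f ^^ k) x)" for k
    using assms(2,3) by (induction k) (auto simp: forward_orbit_def)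
  then show ?thesis using assms(1) by (auto simp: forward_orbit_def)
qed

lemma forward_orbit_trans:
  assumes "z \<in> forward_orbit f y" "y \<in> forward_orbit f x"
  shows "z \<in> forward_orbit f x"
  using assms by (induction rule: forward_orbit_induct) (auto intro: forward_orbit_step)

lemma hits_iff: "hits S f R \<longleftrightarrow> R \<subseteq> S \<and> (\<forall>i\<in>S. \<exists>r\<in>R. i \<in> forward_orbit f r)"
  unfolding hits_def forward_orbit_def by (metis (mono_tags, lifting) image_iff rangeI)

text \<open>A step can be undone by going forward, since \<open>f\<close> has finite order. Hence
  forward orbits are whole cycles and membership in them is symmetric.\<close>

lemma permutes_return:
  assumes "finite S" "f permutes S"
  shows "x \<in> forward_orbit f (f x)"
proof -
  obtain n where n: "f ^^ n = id" "n > 0"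
    using permutation_is_nilpotent permutation_permutes assms by metis
  then obtain m where "n = Suc m" by (cases n) auto
  then have "(f ^^ m) (f x) = x"
    using n(1) by (metis comp_apply funpow_Suc_right id_apply)
  then show ?thesis unfolding forward_orbit_def by (metis rangeI)
qed

lemma forward_orbit_sym:
  assumes "finite S" "f permutes S" "y \<in> forward_orbit f x"
  shows "x \<in> forward_orbit f y"
  using assms(3)
  by (induction rule: forward_orbit_induct)
    (use permutes_return[OF assms(1,2)] forward_orbit_trans forward_orbit_self in metis)+

section \<open>Effect of one transposition on the cycles\<close>

context
  fixes S :: "'a set" and f g :: "'a \<Rightarrow> 'a" and a b :: 'a and R :: "'a set"
  assumes fin: "finite S" and perm: "f permutes S" and ab: "a \<in> S" "b \<in> S"
    and R: "hits S f R" and g: "g = f \<circ> transpose a b"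
begin

text \<open>Representatives of the cycles that avoid both \<open>a\<close> and \<open>b\<close>;
  composing with the transposition leaves these cycles alone.\<close>

private abbreviation "R0 \<equiv> {r \<in> R. r \<notin> forward_orbit f a \<and> r \<notin> forward_orbit f b}"

private lemma step': "x \<noteq> a \<Longrightarrow> x \<noteq> b \<Longrightarrow> g x = f x" "g a = f b" "g b = f a"
  by (auto simp: g transpose_def)

private lemma finR: "finite R"
  using R fin finite_subset unfolding hits_iff by blast

text \<open>Where an \<open>f\<close>-walk meets \<open>a\<close> or \<open>b\<close>, its next
  point is the \<open>g\<close>-image of the other of the two. So every point of a disturbed cycle
  is still reached from \<open>a\<close> or \<open>b\<close>.\<close>

private lemma cover:
  assumes "i \<in> S"
  shows "i \<in> forward_orbit g a \<or> i \<in> forward_orbit g b \<or> (\<exists>r\<in>R0. i \<in> forward_orbit g r)"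
proof -
  obtain r where r: "r \<in> R" "i \<in> forward_orbit f r"
    using R assms unfolding hits_iff by blast
  show ?thesis
  proof (cases "r \<in> R0")
    case True
    from r(2) have "i \<in> forward_orbit g r"
    proof (induction rule: forward_orbit_induct)
      case self
      then show ?case by (rule forward_orbit_self)
    next
      case (step y)
      have "y \<noteq> a" "y \<noteq> b"
        using True step(1) forward_orbit_sym[OF fin perm] by auto
      then show ?case using forward_orbit_step[OF step(2)] step'(1) by metis
    qed
    then show ?thesis using True by blast
  next
    case False
    then obtain c where c: "c = a \<or> c = b" "i \<in> forward_orbit f c"
      using r forward_orbit_trans by (metis (mono_tags, lifting) mem_Collect_eq)
    from c(2) have "i \<in> forward_orbit g a \<union> forward_orbit g b"
    proof (induction rule: forward_orbit_induct)
      case self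
      then show ?case using c(1) forward_orbit_self[of _ g] by blast
    next
      case (step y)
      consider "y = a" | "y = b" | "y \<noteq> a" "y \<noteq> b" by blast
      then show ?case
      proof cases
        case 1
        then show ?thesis using forward_orbit_step[OF forward_orbit_self[of b g]] step'(3,2) by simp
      next
        case 2
        then show ?thesis using forward_orbit_step[OF forward_orbit_self[of a g]] step'(3,2) by simp
      next
        case 3
        then show ?thesis using step(2) forward_orbit_step[of y g] step'(1) by auto
      qed
    qed
    then show ?thesis by blast
  qed
qed

text \<open>At least the representative of the cycle of \<open>a\<close> leaves \<open>R\<close>,
  while \<open>a\<close> and \<open>b\<close> enter: a net growth of at most one.\<close>

lemma hits_comp_transpose: "\<exists>R'. hits S g R' \<and> card R' \<le> card R + 1"
proof -
  obtain r where r: "r \<in> R" "a \<in> forward_orbit f r"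
    using R ab unfolding hits_iff by blast
  then have "r \<notin> R0" using forward_orbit_sym[OF fin perm] by blast
  then have "R0 \<subset> R" using r by blast
  then have "card R0 < card R" by (rule psubset_card_mono[OF finR])
  moreover have "card (insert a (insert b R0)) \<le> card R0 + 2"
    using finR by (simp add: card_insert_if)
  moreover have "hits S g (insert a (insert b R0))"
    using cover R ab unfolding hits_iff by blast
  ultimately show ?thesis by (intro exI[of _ "insert a (insert b R0)"]) auto
qed

text \<open>Two distinct cycles lose at least one representative each, and \<open>a\<close> alone
  replaces them because the two cycles become one.\<close>

lemma hits_comp_transpose_merge:
  assumes "b \<notin> forward_orbit f a"
  shows "\<exists>R'. hits S g R' \<and> card R' + 1 \<le> card R"
proof -
  obtain r where r: "r \<in> R" "a \<in> forward_orbit f r"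
    using R ab unfolding hits_iff by blast
  obtain s where s: "s \<in> R" "b \<in> forward_orbit f s"
    using R ab unfolding hits_iff by blast
  have r': "r \<in> forward_orbit f a" and s': "s \<in> forward_orbit f b"
    using forward_orbit_sym[OF fin perm] r s by blast+
  have "r \<noteq> s" using assms r' s forward_orbit_trans by metis
  have "R0 \<subseteq> R - {r, s}" using r' s' by blast
  then have "card R0 \<le> card (R - {r, s})" using finR by (meson card_mono finite_Diff)
  also have "\<dots> = card R - 2" using r s \<open>r \<noteq> s\<close> by (simp add: card_Diff_subset)
  finally have "card R0 \<le> card R - 2" .
  moreover have "card R \<ge> 2"
    using card_mono[OF finR, of "{r, s}"] r s \<open>r \<noteq> s\<close> by simp
  moreover have "card (insert a R0) \<le> card R0 + 1"
    using finR by (simp add: card_insert_if)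
  moreover have "hits S g (insert a R0)"
  proof -
    \<comment> \<open>Since \<open>g a = f b\<close>, the \<open>g\<close>-walk from
      \<open>a\<close> enters the \<open>f\<close>-cycle of \<open>b\<close>, which does not contain
      \<open>a\<close>, and follows it round to \<open>b\<close>.\<close>
    have "y \<in> forward_orbit g a" if "y \<in> forward_orbit f (f b)" for y
      using that
    proof (induction rule: forward_orbit_induct)
      case self
      then show ?case using forward_orbit_step[OF forward_orbit_self[of a g]] step'(2) by metis
    next
      case (step y)
      have "y \<in> forward_orbit f b"
        using step(1) forward_orbit_step[OF forward_orbit_self] by (rule forward_orbit_trans)
      then have "y \<noteq> a" using forward_orbit_sym[OF fin perm] assms by blast
      then show ?case
        using forward_orbit_step[OF step(2)] forward_orbit_step[OF forward_orbit_self[of a g]]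
          step'(1)[of y] step'(2)
        by (cases "y = b") simp_all
    qed
    then have "b \<in> forward_orbit g a" using permutes_return[OF fin perm] by blast
    then have "i \<in> forward_orbit g a \<or> (\<exists>r\<in>R0. i \<in> forward_orbit g r)" if "i \<in> S" for i
      using cover[OF that] forward_orbit_trans[OF _ \<open>b \<in> forward_orbit g a\<close>] by blast
    then show ?thesis
      using R ab(1) unfolding hits_iff by blast
  qed
  ultimately show ?thesis by (intro exI[of _ "insert a R0"]) auto
qed

end

section \<open>The graph formed by the transpositions\<close>

definition edge_rel :: "('a \<times> 'a) list \<Rightarrow> ('a \<times> 'a) set" where
  "edge_rel xs = (set xs \<union> (set xs)\<inverse>)\<^sup>*"

text \<open>
  Loops \<open>(a, a)\<close> are allowed and stand for the identity permutation, so that diagonal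
  reflections need no separate treatment.
\<close>

definition prod_transpose :: "('a \<times> 'a) list \<Rightarrow> 'a \<Rightarrow> 'a" where
  "prod_transpose xs = foldr (\<lambda>(a, b) g. g \<circ> transpose a b) xs id"

lemma prod_transpose_simps [simp]:
  "prod_transpose [] = id"
  "prod_transpose ((a, b) # xs) = prod_transpose xs \<circ> transpose a b"
  by (simp_all add: prod_transpose_def)

lemma prod_transpose_permutes:
  "set xs \<subseteq> S \<times> S \<Longrightarrow> prod_transpose xs permutes S"
proof (induction xs)
  case Nil
  then show ?case using permutes_id by (simp add: id_def)
next
  case (Cons x xs)
  obtain a b where x: "x = (a, b)" by force
  then have "transpose a b permutes S" using Cons.prems by (auto intro: permutes_swap_id)
  moreover have "prod_transpose xs permutes S" using Cons by auto
  ultimately show ?case unfolding x prod_transpose_simps by (rule permutes_compose)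
qed

lemma edge_rel_equiv: "sym (edge_rel xs)" "trans (edge_rel xs)" "(x, x) \<in> edge_rel xs"
  unfolding edge_rel_def
  by (auto intro!: sym_rtrancl trans_rtrancl simp: sym_Un_converse)

lemma edge_rel_Cons_mono: "edge_rel xs \<subseteq> edge_rel (x # xs)"
  unfolding edge_rel_def by (rule rtrancl_mono) auto

lemma edge_rel_head: "(a, b) \<in> edge_rel ((a, b) # xs)"
  unfolding edge_rel_def by (rule r_into_rtrancl) auto

lemma prod_transpose_edge_rel: "(x, prod_transpose xs x) \<in> edge_rel xs"
proof (induction xs arbitrary: x)
  case Nil
  then show ?case by (simp add: edge_rel_equiv)
next
  case (Cons p xs)
  obtain a b where p: "p = (a, b)" by force
  have "(x, transpose a b x) \<in> edge_rel (p # xs)"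
    using edge_rel_head[of a b xs] edge_rel_equiv(3) symD[OF edge_rel_equiv(1)] p
    by (auto simp: transpose_def)
  moreover have "(transpose a b x, prod_transpose (p # xs) x) \<in> edge_rel (p # xs)"
    using Cons.IH edge_rel_Cons_mono p by fastforce
  ultimately show ?case using edge_rel_equiv(2) by (metis transD)
qed

text \<open>Crossing the new edge back returns to the component left before, so one crossing
  suffices; the last two disjuncts record its direction.\<close>

lemma edge_rel_ConsD:
  assumes "(x, y) \<in> edge_rel ((a, b) # xs)"
  shows "(x, y) \<in> edge_rel xs \<or> (x, a) \<in> edge_rel xs \<and> (b, y) \<in> edge_rel xs
    \<or> (x, b) \<in> edge_rel xs \<and> (a, y) \<in> edge_rel xs"
  using assms unfolding edge_rel_def[of "(a, b) # xs"]
proof (induction rule: rtrancl_induct)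
  case base
  then show ?case by (simp add: edge_rel_equiv)
next
  case (step y z)
  have tr: "(u, w) \<in> edge_rel xs" if "(u, v) \<in> edge_rel xs" "(v, w) \<in> edge_rel xs" for u v w
    using that edge_rel_equiv(2) by (metis transD)
  have sy: "(v, u) \<in> edge_rel xs" if "(u, v) \<in> edge_rel xs" for u v
    using that edge_rel_equiv(1) by (metis symD)
  from step(2) consider "(y, z) \<in> set xs \<union> (set xs)\<inverse>" | "y = a" "z = b" | "y = b" "z = a"
    by auto
  then show ?case
  proof cases
    case 1
    then have "(y, z) \<in> edge_rel xs" unfolding edge_rel_def by blast
    then show ?thesis using step(3) tr by metis
  next
    case 2
    then show ?thesis using step(3) tr sy edge_rel_equiv(3) by metis
  next
    case 3
    then show ?thesis using step(3) tr sy edge_rel_equiv(3) by metis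
  qed
qed

text \<open>\<open>C\<close> is to the components of the graph what \<open>R\<close> is to the
  cycles: a set meeting each of them. It stays arbitrary so that the induction can enlarge it when
  an edge is removed.\<close>

lemma prod_transpose_hits:
  assumes "finite S" "set xs \<subseteq> S \<times> S" "C \<subseteq> S" "\<forall>i\<in>S. \<exists>c\<in>C. (c, i) \<in> edge_rel xs"
  shows "\<exists>R. hits S (prod_transpose xs) R \<and> card R + card S \<le> 2 * card C + length xs"
  using assms(2-4)
proof (induction xs arbitrary: C)
  case Nil
  \<comment> \<open>Without edges every point is its own component, so \<open>C\<close> is all of
    \<open>S\<close>, and \<open>S\<close> serves as \<open>R\<close>.\<close>
  then have "C = S" by (auto simp: edge_rel_def)
  then show ?case by (intro exI[of _ S]) (use forward_orbit_self in \<open>fastforce simp: hits_iff\<close>)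
next
  case (Cons p xs)
  obtain a b where p: "p = (a, b)" by force
  have S: "set xs \<subseteq> S \<times> S" "a \<in> S" "b \<in> S" using Cons.prems p by auto
  note perm = prod_transpose_permutes[OF S(1)]
  note tr = transD[OF edge_rel_equiv(2)]
  note sy = symD[OF edge_rel_equiv(1)]
  have finC: "finite C" using Cons.prems assms(1) finite_subset by blast
  show ?case
  proof (cases "(a, b) \<in> edge_rel xs")
    case True
    \<comment> \<open>An edge inside a component leaves the components unchanged; the possible
      additional cycle is paid for by the additional factor.\<close>
    have "edge_rel (p # xs) \<subseteq> edge_rel xs"
      using edge_rel_ConsD[of _ _ a b xs] True tr sy unfolding p by (meson subrelI)
    then have "\<forall>i\<in>S. \<exists>c\<in>C. (c, i) \<in> edge_rel xs" using Cons.prems by blast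
    from Cons.IH[OF S(1) Cons.prems(2) this] obtain R where
      R: "hits S (prod_transpose xs) R" "card R + card S \<le> 2 * card C + length xs" by blast
    from hits_comp_transpose[OF assms(1) perm S(2,3) R(1) refl] obtain R' where
      "hits S (prod_transpose (p # xs)) R'" "card R' \<le> card R + 1"
      using p by auto
    then show ?thesis using R(2) by (intro exI[of _ R']) auto
  next
    case False
    \<comment> \<open>The new edge joins two components: one more vertex \<open>d\<close> is needed to meet the
      components without it, and in exchange two cycles of the product merge.\<close>
    have "\<exists>d\<in>{a, b}. \<forall>i\<in>S. \<exists>c\<in>insert d C. (c, i) \<in> edge_rel xs"
    proof -
      \<comment> \<open>Some \<open>c\<close> in \<open>C\<close> is joined to one end of the new
        edge already in the old graph; \<open>d\<close> is the other end.\<close>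
      obtain c where c: "c \<in> C" "(c, a) \<in> edge_rel (p # xs)" using bspec[OF Cons.prems(3) S(2)] by blast
      consider "(c, a) \<in> edge_rel xs" | "(c, b) \<in> edge_rel xs"
        using edge_rel_ConsD[OF c(2)[unfolded p]] by blast
      then show ?thesis
      proof cases
        case 1
        have "\<exists>c\<in>insert b C. (c, i) \<in> edge_rel xs" if i: "i \<in> S" for i
        proof -
          obtain e where e: "e \<in> C" "(e, i) \<in> edge_rel (p # xs)" using bspec[OF Cons.prems(3) i] by blast
          then consider "(e, i) \<in> edge_rel xs" | "(b, i) \<in> edge_rel xs" | "(a, i) \<in> edge_rel xs"
            using edge_rel_ConsD[OF e(2)[unfolded p]] by blast
          then show ?thesis
          proof cases
            case 3
            then show ?thesis using c(1) tr[OF \<open>(c, a) \<in> edge_rel xs\<close> 3] by blast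
          qed (use e(1) in blast)+
        qed
        then show ?thesis by blast
      next
        case 2
        have "\<exists>c\<in>insert a C. (c, i) \<in> edge_rel xs" if i: "i \<in> S" for i
        proof -
          obtain e where e: "e \<in> C" "(e, i) \<in> edge_rel (p # xs)" using bspec[OF Cons.prems(3) i] by blast
          then consider "(e, i) \<in> edge_rel xs" | "(a, i) \<in> edge_rel xs" | "(b, i) \<in> edge_rel xs"
            using edge_rel_ConsD[OF e(2)[unfolded p]] by blast
          then show ?thesis
          proof cases
            case 3
            then show ?thesis using c(1) tr[OF \<open>(c, b) \<in> edge_rel xs\<close> 3] by blast
          qed (use e(1) in blast)+
        qed
        then show ?thesis by blast
      qed
    qed
    then obtain d where d: "d \<in> S" "\<forall>i\<in>S. \<exists>c\<in>insert d C. (c, i) \<in> edge_rel xs"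
      using S by blast
    have "insert d C \<subseteq> S" using Cons.prems d by blast
    from Cons.IH[OF S(1) this d(2)] obtain R where
      R: "hits S (prod_transpose xs) R" "card R + card S \<le> 2 * card (insert d C) + length xs"
      by blast
    \<comment> \<open>A cycle of the product stays inside one component of the old graph, and
      \<open>a\<close> and \<open>b\<close> lie in different ones.\<close>
    have "b \<notin> forward_orbit (prod_transpose xs) a"
    proof
      assume "b \<in> forward_orbit (prod_transpose xs) a"
      then have "(a, b) \<in> edge_rel xs"
        by (induction rule: forward_orbit_induct)
          (rule edge_rel_equiv(3), rule tr[OF _ prod_transpose_edge_rel])
      with False show False ..
    qed
    from hits_comp_transpose_merge[OF assms(1) perm S(2,3) R(1) refl this] obtain R' where
      "hits S (prod_transpose (p # xs)) R'" "card R' + 1 \<le> card R"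
      using p by auto
    \<comment> \<open>Balance: the extra vertex costs at most 2, of which the merger gives back 1
      and the longer list 1.\<close>
    moreover have "card (insert d C) \<le> card C + 1" using finC by (simp add: card_insert_if)
    ultimately show ?thesis using R(2) by (intro exI[of _ R']) auto
  qed
qed

section \<open>Matrices of finite order\<close>

text \<open>Fewer than \<open>n\<close> homogeneous linear conditions in \<open>n\<close> unknowns,
  padded with zero rows, form a singular square matrix.\<close>

lemma exists_nonzero_vec_orthogonal:
  fixes fs :: "'a :: idom vec list"
  assumes "set fs \<subseteq> carrier_vec n" "length fs < n"
  shows "\<exists>c\<in>carrier_vec n. c \<noteq> 0\<^sub>v n \<and> (\<forall>f\<in>set fs. f \<bullet> c = 0)"
proof -
  \<comment> \<open>Row \<open>length fs\<close> is split off to give the matrix the shape expected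
    by \<open>det_row_0\<close>.\<close>
  let ?B = "mat\<^sub>r n n (\<lambda>i. if i = length fs then 0\<^sub>v n else if i < length fs then fs ! i else 0\<^sub>v n)"
  have "det ?B = 0"
    by (rule det_row_0) (use assms nth_mem[of _ fs] in \<open>auto simp: subset_iff\<close>)
  then obtain c where c: "c \<in> carrier_vec n" "c \<noteq> 0\<^sub>v n" "?B *\<^sub>v c = 0\<^sub>v n"
    using det_0_iff_vec_prod_zero[of ?B n] by auto
  have "fs ! i \<bullet> c = 0" if "i < length fs" for i
  proof -
    have "(?B *\<^sub>v c) $ i = 0" using c(3) that assms(2) by simp
    moreover have "(?B *\<^sub>v c) $ i = fs ! i \<bullet> c"
      using that assms by (subst index_mult_mat_vec) (auto simp: subset_iff)
    ultimately show ?thesis by simp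
  qed
  then show ?thesis using c by (metis in_set_conv_nth)
qed

text \<open>Serves to pass from a power of a Jordan matrix being the identity to the same for each
  block.\<close>

lemma diag_block_mat_eq_oneD:
  fixes Bs :: "'a :: semiring_1 mat list"
  assumes "\<forall>B\<in>set Bs. square_mat B" "diag_block_mat Bs = 1\<^sub>m n" "B \<in> set Bs"
  shows "B = 1\<^sub>m (dim_row B)"
  using assms
proof (induction Bs arbitrary: n)
  case Nil
  then show ?case by simp
next
  case (Cons A Bs)
  let ?D = "diag_block_mat Bs"
  have sq: "dim_col A = dim_row A" "dim_col ?D = dim_row ?D"
    using Cons.prems(1) diag_block_mat_square[of Bs] by auto
  let ?F = "four_block_mat A (0\<^sub>m (dim_row A) (dim_col ?D)) (0\<^sub>m (dim_row ?D) (dim_col A)) ?D"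
  have F: "?F = 1\<^sub>m n" using Cons.prems(2) by (simp add: Let_def)
  then have n: "n = dim_row A + dim_row ?D"
    by (metis index_mat_four_block(2) index_one_mat(2))
  have "A = 1\<^sub>m (dim_row A)"
  proof (rule eq_matI)
    fix i j assume ij: "i < dim_row (1\<^sub>m (dim_row A))" "j < dim_col (1\<^sub>m (dim_row A))"
    have "?F $$ (i, j) = 1\<^sub>m n $$ (i, j)" using F by simp
    then show "A $$ (i, j) = 1\<^sub>m (dim_row A) $$ (i, j)" using ij sq n by simp
  qed (use sq in auto)
  moreover have "?D = 1\<^sub>m (dim_row ?D)"
  proof (rule eq_matI)
    fix i j assume ij: "i < dim_row (1\<^sub>m (dim_row ?D))" "j < dim_col (1\<^sub>m (dim_row ?D))"
    have "?F $$ (i + dim_row A, j + dim_row A) = 1\<^sub>m n $$ (i + dim_row A, j + dim_row A)"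
      using F by simp
    then show "?D $$ (i, j) = 1\<^sub>m (dim_row ?D) $$ (i, j)" using ij sq n by simp
  qed (use sq in auto)
  ultimately show ?case using Cons.IH Cons.prems by auto
qed

lemma diagonal_mat_diag_block_mat:
  assumes "\<forall>B\<in>set Bs. square_mat B \<and> diagonal_mat B"
  shows "diagonal_mat (diag_block_mat Bs)"
  using assms
proof (induction Bs)
  case Nil
  then show ?case by (simp add: diagonal_mat_def)
next
  case (Cons A Bs)
  have "square_mat (diag_block_mat Bs)"
    using Cons.prems by (intro diag_block_mat_square) auto
  then show ?case using Cons by (auto simp: Let_def diagonal_mat_def)
qed

text \<open>In a block of size at least 2 the power has \<open>a ^ N\<close> on the diagonal and
  \<open>N * a ^ (N - 1)\<close> next to it. The first must be 1 and the second 0, which is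
  impossible in characteristic 0.\<close>

lemma jordan_block_root_of_one:
  fixes a :: complex
  assumes "jordan_block k a ^\<^sub>m N = 1\<^sub>m k" "N > 0"
  shows "k \<le> 1"
proof (rule ccontr)
  assume k: "\<not> k \<le> 1"
  have "(jordan_block k a ^\<^sub>m N) $$ (0, 0) = 1" "(jordan_block k a ^\<^sub>m N) $$ (0, 1) = 0"
    using k assms(1) by auto
  then have "a ^ N = 1" "of_nat N * a ^ (N - 1) = 0"
    using k by (simp_all add: jordan_block_pow)
  then show False using assms(2) by (auto simp: power_0_left)
qed

text \<open>The Jordan form has the same finite order as \<open>A\<close>, so all its blocks have
  size at most 1.\<close>

lemma finite_order_diagonalizable:
  fixes A :: "complex mat"
  assumes A: "A \<in> carrier_mat n n" and N: "A ^\<^sub>m N = 1\<^sub>m n" "N > 0"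
  obtains D P Q where "similar_mat_wit A D P Q" "diagonal_mat D"
proof -
  obtain as where "char_poly A = (\<Prod>a\<leftarrow>as. [:- a, 1:])"
    using char_poly_factorized[OF A] by blast
  then obtain nas where "jordan_nf A nas" using jordan_nf_exists[OF A] by blast
  then obtain P Q where wit: "similar_mat_wit A (jordan_matrix nas) P Q"
    unfolding jordan_nf_def similar_mat_def by blast
  let ?J = "jordan_matrix nas"
  note witD = similar_mat_witD2[OF A wit]
  have "similar_mat_wit (1\<^sub>m n) (?J ^\<^sub>m N) P Q"
    using similar_mat_wit_pow[OF wit, of N] N by simp
  then have "?J ^\<^sub>m N = Q * 1\<^sub>m n * P"
    using similar_mat_witD2(3)[OF _ similar_mat_wit_sym] witD(5) pow_carrier_mat by blast
  then have J: "?J ^\<^sub>m N = 1\<^sub>m n" using witD by simp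
  have "k \<le> 1" if "(k, a) \<in> set nas" for k a
  proof (rule jordan_block_root_of_one[OF _ N(2)])
    let ?B = "jordan_block k a ^\<^sub>m N"
    have "?B = 1\<^sub>m (dim_row ?B)"
      by (rule diag_block_mat_eq_oneD[OF _ J[unfolded jordan_matrix_pow]]) (use that in force)+
    then show "?B = 1\<^sub>m k" by simp
  qed
  then have "diagonal_mat ?J" unfolding jordan_matrix_def
    by (intro diagonal_mat_diag_block_mat) (fastforce simp: diagonal_mat_def)
  with wit show thesis by (rule that)
qed

section \<open>Bounds on eigenvalue multiplicities\<close>

lemma order_prod_linear:
  "Polynomial.order a (\<Prod>b\<leftarrow>bs. [:- b, 1:]) = count_list bs (a :: 'a :: idom)"
proof (induction bs)
  case Nil
  then show ?case by (simp add: order_0I)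
next
  case (Cons b bs)
  have "(\<Prod>b\<leftarrow>b # bs. [:- b, 1:]) \<noteq> 0" by (subst prod_list_zero_iff) auto
  then have "Polynomial.order a (\<Prod>b\<leftarrow>b # bs. [:- b, 1:]) =
    Polynomial.order a [:- b, 1:] + count_list bs a"
    using Cons by (simp add: order_mult del: mult_pCons_left)
  then show ?case using order_linear_power[of a "- b" 1] by auto
qed

lemma order_char_poly_diagonal:
  fixes A :: "'a :: idom mat"
  assumes A: "A \<in> carrier_mat n n" and "similar_mat_wit A D P Q" "diagonal_mat D"
  shows "Polynomial.order a (char_poly A) = card {i. i < n \<and> D $$ (i, i) = a}"
proof -
  have D: "D \<in> carrier_mat n n" using similar_mat_witD2[OF assms(1,2)] by blast
  have "char_poly A = char_poly D"
    using assms(2) by (intro char_poly_similar) (auto simp: similar_mat_def)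
  also have "\<dots> = (\<Prod>a\<leftarrow>diag_mat D. [:- a, 1:])"
    using assms(3) D by (intro char_poly_upper_triangular[OF D]) (auto simp: diagonal_mat_def)
  finally have "Polynomial.order a (char_poly A) = count_list (diag_mat D) a"
    by (simp add: order_prod_linear)
  also have "\<dots> = card {i. i < n \<and> D $$ (i, i) = a}"
    using D by (auto simp: diag_mat_def count_list_eq_length_filter length_filter_conv_card
        intro!: arg_cong[where f = card])
  finally show ?thesis .
qed

text \<open>As \<open>A\<close> is diagonalizable, the eigenspace has the multiplicity as dimension.
  If this exceeded \<open>card R\<close>, the conditions of vanishing on \<open>R\<close> would
  leave a nonzero eigenvector, against \<open>inj\<close>.\<close>

lemma eigenvalue_mult_le_card:
  assumes A: "A \<in> carrier_mat n n" and N: "A ^\<^sub>m N = 1\<^sub>m n" "N > 0"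
    and R: "R \<subseteq> {..<n}"
    and inj: "\<And>v. v \<in> carrier_vec n \<Longrightarrow> A *\<^sub>v v = a \<cdot>\<^sub>v v \<Longrightarrow> \<forall>r\<in>R. v $ r = 0 \<Longrightarrow> v = 0\<^sub>v n"
  shows "eigenvalue_mult A a \<le> card R"
proof (rule ccontr)
  assume less: "\<not> eigenvalue_mult A a \<le> card R"
  obtain D P Q where wit: "similar_mat_wit A D P Q" and diag: "diagonal_mat D"
    using finite_order_diagonalizable[OF A N] .
  note witD = similar_mat_witD2[OF A wit]
  let ?E = "{i. i < n \<and> D $$ (i, i) = a}"
  have less: "card R < card ?E"
    using less order_char_poly_diagonal[OF A wit diag] by (simp add: eigenvalue_mult_def)
  have finR: "finite R" using R finite_subset by blast
  \<comment> \<open>Conditions on the coordinates \<open>c\<close> of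
    \<open>v = P *\<^sub>v c\<close> in an eigenbasis: rows of \<open>P\<close> make
    \<open>v\<close> vanish on \<open>R\<close>, unit vectors confine \<open>c\<close> to the
    eigenvalue \<open>a\<close>. There are \<open>card R + (n - card ?E)\<close> of them, fewer than
    \<open>n\<close>.\<close>
  define fs where "fs = map (row P) (sorted_list_of_set R)
    @ map (unit_vec n) (sorted_list_of_set ({..<n} - ?E))"
  have "card ({..<n} - ?E) = n - card ?E"
    by (subst card_Diff_subset) auto
  moreover have "card ?E \<le> n"
    using card_mono[of "{..<n}" ?E] by auto
  ultimately have "length fs < n" using less by (simp add: fs_def)
  moreover have "set fs \<subseteq> carrier_vec n"
    using R finR witD by (auto simp: fs_def)
  ultimately obtain c where c: "c \<in> carrier_vec n" "c \<noteq> 0\<^sub>v n" "\<forall>f\<in>set fs. f \<bullet> c = 0"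
    using exists_nonzero_vec_orthogonal by blast
  have c0: "c $ i = 0" if "i < n" "D $$ (i, i) \<noteq> a" for i
  proof -
    have "unit_vec n i \<in> set fs" using that by (simp add: fs_def)
    then have "unit_vec n i \<bullet> c = 0" using c(3) by blast
    then show ?thesis using c(1) that(1) by simp
  qed
  have Dc: "D *\<^sub>v c = a \<cdot>\<^sub>v c"
  proof (rule eq_vecI)
    fix i assume "i < dim_vec (a \<cdot>\<^sub>v c)"
    then have i: "i < n" using c(1) by simp
    have "(D *\<^sub>v c) $ i = (\<Sum>j\<in>{0..<n}. D $$ (i, j) * c $ j)"
      using i c(1) witD(5) by (simp add: scalar_prod_def)
    also have "\<dots> = (\<Sum>j\<in>{0..<n}. if j = i then D $$ (i, i) * c $ i else 0)"
      using diag i witD(5) by (intro sum.cong) (auto simp: diagonal_mat_def)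
    also have "\<dots> = a * c $ i" using i c0[OF i] by auto
    finally show "(D *\<^sub>v c) $ i = (a \<cdot>\<^sub>v c) $ i" using i c(1) by simp
  qed (use c(1) witD(5) in auto)
  define v where "v = P *\<^sub>v c"
  have v: "v \<in> carrier_vec n" using c(1) witD by (simp add: v_def)
  have Qv: "Q *\<^sub>v v = c"
    unfolding v_def using witD c(1) by (metis assoc_mult_mat_vec one_mult_mat_vec)
  have "A *\<^sub>v v = P *\<^sub>v (D *\<^sub>v (Q *\<^sub>v v))"
    unfolding witD(3) using witD(5-7) v by (simp add: assoc_mult_mat_vec[of _ n n _ n])
  also have "\<dots> = a \<cdot>\<^sub>v v"
    unfolding Qv Dc unfolding v_def using witD(6) c(1) by (rule mult_mat_vec)
  finally have "A *\<^sub>v v = a \<cdot>\<^sub>v v" .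
  moreover have "\<forall>r\<in>R. v $ r = 0"
    using c(3) finR R witD(6) by (auto simp: v_def fs_def)
  ultimately have "v = 0\<^sub>v n" using inj v by blast
  then have "c = 0\<^sub>v n" using Qv witD(7) by auto
  then show False using c(2) by contradiction
qed

section \<open>Monomial matrices\<close>

text \<open>The permutation is read along rows, so entry \<open>i\<close> of
  \<open>A *\<^sub>v v\<close> involves only \<open>v $ f i\<close>, and zeros of an eigenvector
  spread along forward orbits of \<open>f\<close>.\<close>

definition monomial_mat :: "nat \<Rightarrow> 'a :: zero mat \<Rightarrow> (nat \<Rightarrow> nat) \<Rightarrow> bool" where
  "monomial_mat n A f \<longleftrightarrow> A \<in> carrier_mat n n \<and> f permutes {..<n} \<and>
    (\<forall>i<n. \<forall>j<n. A $$ (i, j) \<noteq> 0 \<longleftrightarrow> j = f i)"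

lemma generalized_permutation_mat_monomial:
  assumes "generalized_permutation_mat n A"
  obtains f where "monomial_mat n A f"
proof -
  have A: "A \<in> carrier_mat n n"
    and row: "\<And>i. i < n \<Longrightarrow> \<exists>!j. j < n \<and> A $$ (i, j) \<noteq> 0"
    and col: "\<And>j. j < n \<Longrightarrow> \<exists>!i. i < n \<and> A $$ (i, j) \<noteq> 0"
    using assms by (auto simp: generalized_permutation_mat_def)
  \<comment> \<open>The identity beyond \<open>n\<close>, as \<open>permutes\<close>
    demands.\<close>
  define f where "f i = (if i < n then THE j. j < n \<and> A $$ (i, j) \<noteq> 0 else i)" for i
  have f: "f i < n \<and> A $$ (i, f i) \<noteq> 0" if "i < n" for i
    using theI'[OF row[OF that]] that by (simp add: f_def)
  have "inj_on f {..<n}"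
    using f col by (intro inj_onI) (metis lessThan_iff)
  moreover have "f ` {..<n} \<subseteq> {..<n}" using f by auto
  ultimately have "bij_betw f {..<n} {..<n}"
    by (simp add: bij_betw_def endo_inj_surj)
  then have "f permutes {..<n}" by (rule bij_imp_permutes) (simp add: f_def)
  moreover have "A $$ (i, j) \<noteq> 0 \<longleftrightarrow> j = f i" if "i < n" "j < n" for i j
    using row[OF that(1)] f[OF that(1)] that by blast
  ultimately show thesis using A by (intro that[of f]) (auto simp: monomial_mat_def)
qed

lemma monomial_mat_lt: "monomial_mat n A f \<Longrightarrow> i < n \<Longrightarrow> f i < n"
  unfolding monomial_mat_def using permutes_in_image[of f "{..<n}" i] by auto

lemma monomial_mat_mult_sum:
  fixes A :: "'a :: semiring_0 mat"
  assumes "monomial_mat n A f" "i < n"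
  shows "(\<Sum>j\<in>{0..<n}. A $$ (i, j) * g j) = A $$ (i, f i) * g (f i)"
proof -
  have "(\<Sum>j\<in>{0..<n}. A $$ (i, j) * g j) = (\<Sum>j\<in>{f i}. A $$ (i, j) * g j)"
  proof (rule sum.mono_neutral_right)
    show "\<forall>j\<in>{0..<n} - {f i}. A $$ (i, j) * g j = 0"
      using assms unfolding monomial_mat_def by (metis Diff_iff atLeastLessThan_iff mult_zero_left singletonI)
  qed (use monomial_mat_lt[OF assms] in auto)
  then show ?thesis by simp
qed

lemma monomial_mat_mult_vec:
  fixes A :: "'a :: semiring_0 mat"
  assumes "monomial_mat n A f" "i < n" "v \<in> carrier_vec n"
  shows "(A *\<^sub>v v) $ i = A $$ (i, f i) * v $ f i"
proof -
  have "A \<in> carrier_mat n n" using assms(1) by (simp add: monomial_mat_def)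
  then show ?thesis
    using monomial_mat_mult_sum[OF assms(1,2), of "\<lambda>j. v $ j"] assms(2,3)
    by (simp add: scalar_prod_def)
qed

lemma monomial_mat_mult:
  fixes A :: "'a :: semiring_no_zero_divisors mat"
  assumes "monomial_mat n A f" "monomial_mat n B g"
  shows "monomial_mat n (A * B) (g \<circ> f)"
proof -
  have carr: "A \<in> carrier_mat n n" "B \<in> carrier_mat n n"
    using assms by (simp_all add: monomial_mat_def)
  have "(A * B) $$ (i, j) \<noteq> 0 \<longleftrightarrow> j = g (f i)" if "i < n" "j < n" for i j
  proof -
    have "(A * B) $$ (i, j) = A $$ (i, f i) * B $$ (f i, j)"
      using monomial_mat_mult_sum[OF assms(1) that(1), of "\<lambda>k. B $$ (k, j)"] carr that
      by (simp add: scalar_prod_def)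
    then show ?thesis
      using assms that monomial_mat_lt[OF assms(1) that(1)] by (auto simp: monomial_mat_def)
  qed
  then show ?thesis
    using assms carr permutes_compose[of f "{..<n}" g] by (simp add: monomial_mat_def)
qed

lemma monomial_mat_one: "monomial_mat n (1\<^sub>m n :: 'a :: zero_neq_one mat) id"
  by (auto simp: monomial_mat_def permutes_id[unfolded id_def] id_def)

lemma hits_vec_eq_zero:
  assumes "hits {..<n} f R" "v \<in> carrier_vec n" "\<forall>r\<in>R. v $ r = 0" "f permutes {..<n}"
    and "\<And>i. i < n \<Longrightarrow> v $ i = 0 \<Longrightarrow> v $ f i = 0"
  shows "v = 0\<^sub>v n"
proof (rule eq_vecI)
  fix i assume "i < dim_vec (0\<^sub>v n)"
  then have "i \<in> {..<n}" by simp
  then obtain r where r: "r \<in> R" "i \<in> forward_orbit f r" "r < n"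
    using assms(1) unfolding hits_iff by blast
  from r(2) have "i < n \<and> v $ i = 0"
  proof (induction rule: forward_orbit_induct)
    case self
    then show ?case using r assms(3) by blast
  next
    case (step i)
    then show ?case using assms(5) permutes_in_image[OF assms(4), of i] by auto
  qed
  then show "v $ i = 0\<^sub>v n $ i" by simp
qed (use assms(2) in simp)

text \<open>Row \<open>i\<close> of the eigenvector equation makes \<open>v $ f i\<close> a multiple
  of \<open>v $ i\<close>, so an eigenvector vanishing on \<open>R\<close> is zero.\<close>

lemma monomial_mat_eigenvalue_mult_le:
  assumes A: "monomial_mat n A f" and N: "A ^\<^sub>m N = 1\<^sub>m n" "N > 0" and R: "hits {..<n} f R"
  shows "eigenvalue_mult A a \<le> card R"
proof (rule eigenvalue_mult_le_card[OF _ N])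
  fix v assume v: "v \<in> carrier_vec n" "A *\<^sub>v v = a \<cdot>\<^sub>v v" "\<forall>r\<in>R. v $ r = 0"
  have "v $ f i = 0" if "i < n" "v $ i = 0" for i
  proof -
    have "A $$ (i, f i) * v $ f i = 0"
      using monomial_mat_mult_vec[OF A that(1) v(1)] v(1,2) that by simp
    moreover have "A $$ (i, f i) \<noteq> 0"
      using A that(1) monomial_mat_lt[OF A that(1)] by (simp add: monomial_mat_def)
    ultimately show ?thesis by simp
  qed
  then show "v = 0\<^sub>v n" using hits_vec_eq_zero[OF R v(1,3)] A by (simp add: monomial_mat_def)
qed (use A R in \<open>auto simp: monomial_mat_def hits_def\<close>)

text \<open>Applying \<open>A\<close> to the eigenvector equation of \<open>B\<close> gives
  \<open>v = a \<cdot>\<^sub>v (A *\<^sub>v v)\<close>. Zeros thus spread along \<open>f\<close>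
  itself, and the inverse permutation need not be discussed.\<close>

lemma inverse_monomial_mat_eigenvalue_mult_le:
  assumes A: "monomial_mat n A f" and B: "B \<in> carrier_mat n n" "A * B = 1\<^sub>m n"
    and N: "B ^\<^sub>m N = 1\<^sub>m n" "N > 0" and R: "hits {..<n} f R"
  shows "eigenvalue_mult B a \<le> card R"
proof (rule eigenvalue_mult_le_card[OF B(1) N])
  fix v assume v: "v \<in> carrier_vec n" "B *\<^sub>v v = a \<cdot>\<^sub>v v" "\<forall>r\<in>R. v $ r = 0"
  have Ac: "A \<in> carrier_mat n n" using A by (simp add: monomial_mat_def)
  have "v = A *\<^sub>v (B *\<^sub>v v)"
    using Ac B v(1) by (metis assoc_mult_mat_vec one_mult_mat_vec)
  also have "\<dots> = a \<cdot>\<^sub>v (A *\<^sub>v v)"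
    unfolding v(2) using Ac v(1) by (rule mult_mat_vec)
  finally have eq: "v = a \<cdot>\<^sub>v (A *\<^sub>v v)" .
  have entry: "v $ i = a * (A $$ (i, f i) * v $ f i)" if "i < n" for i
    using arg_cong[OF eq, of "\<lambda>w. w $ i"] monomial_mat_mult_vec[OF A that v(1)] Ac that by simp
  have "v $ f i = 0" if "i < n" "v $ i = 0" for i
  proof -
    have "f i < n" by (rule monomial_mat_lt[OF A that(1)])
    moreover have "A $$ (i, f i) \<noteq> 0"
      using A that(1) monomial_mat_lt[OF A that(1)] by (simp add: monomial_mat_def)
    \<comment> \<open>For nonzero \<open>a\<close> the entry at \<open>i\<close> gives the claim;
      for \<open>a = 0\<close> the entry at \<open>f i\<close> does.\<close>
    ultimately show ?thesis using entry[OF that(1)] entry[of "f i"] that(2) by auto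
  qed
  then show "v = 0\<^sub>v n" using hits_vec_eq_zero[OF R v(1,3)] A by (simp add: monomial_mat_def)
qed (use R in \<open>auto simp: hits_def\<close>)

section \<open>Reflections among monomial matrices\<close>

lemma reflection_eigenvalue_mult_one:
  assumes "is_reflection n A"
  shows "eigenvalue_mult A 1 + 1 = n"
proof -
  obtain k a where A: "A \<in> carrier_mat n n" and k: "A ^\<^sub>m k = 1\<^sub>m n" "k > 0"
    and a: "{b. eigenvalue A b \<and> b \<noteq> 1} = {a}" "eigenvalue_mult A a = 1"
    using assms by (auto simp: is_reflection_def GL_def Units_def units_of_def ring_mat_simps)
  obtain D P Q where wit: "similar_mat_wit A D P Q" "diagonal_mat D"
    using finite_order_diagonalizable[OF A k] .
  note ord = order_char_poly_diagonal[OF A wit]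
  \<comment> \<open>Every diagonal entry is an eigenvalue, so the multiplicities of \<open>1\<close>
    and \<open>a\<close> add up to \<open>n\<close>.\<close>
  have "D $$ (i, i) = 1 \<or> D $$ (i, i) = a" if "i < n" for i
  proof -
    have "card {j. j < n \<and> D $$ (j, j) = D $$ (i, i)} \<noteq> 0" using that by auto
    then have "Polynomial.order (D $$ (i, i)) (char_poly A) \<noteq> 0" by (simp add: ord)
    then have "eigenvalue A (D $$ (i, i))"
      unfolding eigenvalue_root_char_poly[OF A] by (metis order_0I)
    then show ?thesis using a(1) by auto
  qed
  then have "{..<n} = {i. i < n \<and> D $$ (i, i) = 1} \<union> {i. i < n \<and> D $$ (i, i) = a}" by auto
  moreover have "a \<noteq> 1" using a(1) by blast
  ultimately have "card {..<n} =
      card {i. i < n \<and> D $$ (i, i) = 1} + card {i. i < n \<and> D $$ (i, i) = a}"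
    by (simp only:) (rule card_Un_disjoint, auto)
  then show ?thesis using a(2) by (simp add: eigenvalue_mult_def ord)
qed

text \<open>If a point besides \<open>i\<close> and \<open>f i\<close> were moved, two points could
  be dropped from the representatives, and the eigenvalue \<open>1\<close> would have multiplicity
  at most \<open>n - 2\<close> instead of \<open>n - 1\<close>.\<close>

lemma reflection_monomial_mat_transpose:
  assumes A: "monomial_mat n A f" and refl: "is_reflection n A"
  obtains a b where "a < n" "b < n" "f = transpose a b"
proof (cases "\<exists>i. f i \<noteq> i")
  case False
  \<comment> \<open>The loop at \<open>0\<close> encodes the identity; having a reflection forces
    \<open>n > 0\<close>, so \<open>0\<close> is an admissible index.\<close>
  then have "f = transpose 0 0" by auto
  moreover have "n > 0" using reflection_eigenvalue_mult_one[OF refl] by simp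
  ultimately show ?thesis using that by blast
next
  case True
  then obtain i where i: "f i \<noteq> i" by blast
  have perm: "f permutes {..<n}" using A by (simp add: monomial_mat_def)
  note inj = permutes_inj[OF perm, THEN injD]
  have lt: "k < n" "f k < n" if "f k \<noteq> k" for k
    using that permutes_not_in[OF perm, of k] permutes_in_image[OF perm, of k] by auto
  have fixed: "f k = k" if k: "k \<noteq> i" "k \<noteq> f i" for k
  proof (rule ccontr)
    assume moved: "f k \<noteq> k"
    \<comment> \<open>Both dropped points are reached from \<open>?R\<close>: \<open>f k\<close>
      from \<open>k\<close>, and \<open>f i\<close> from \<open>i\<close>, or in two steps from
      \<open>k\<close> if \<open>i = f k\<close>.\<close>
    let ?R = "{..<n} - {f i, f k}"
    have ne: "f i \<noteq> f k" using inj k(1) by blast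
    have "\<exists>r\<in>?R. j \<in> forward_orbit f r" if "j < n" for j
    proof -
      have k': "k \<in> ?R" using k moved lt by auto
      have fk: "f k \<in> forward_orbit f k" by (intro forward_orbit_step forward_orbit_self)
      consider "j = f k" | "j = f i" "i = f k" | "j = f i" "i \<noteq> f k" | "j \<in> ?R" using \<open>j < n\<close> by blast
      then show ?thesis
      proof cases
        case 1
        then show ?thesis using k' fk by blast
      next
        case 2
        then show ?thesis using k' forward_orbit_step[OF fk] by auto
      next
        case 3
        then have "i \<in> ?R" using i lt by auto
        moreover have "j \<in> forward_orbit f i"
          unfolding 3(1) by (intro forward_orbit_step forward_orbit_self)
        ultimately show ?thesis by blast
      next
        case 4
        then show ?thesis using forward_orbit_self[of j f] by blast
      qed
    qed
    then have "hits {..<n} f ?R" by (auto simp: hits_iff)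
    moreover obtain N where "A ^\<^sub>m N = 1\<^sub>m n" "N > 0"
      using refl by (auto simp: is_reflection_def)
    ultimately have "eigenvalue_mult A 1 \<le> card ?R"
      using monomial_mat_eigenvalue_mult_le[OF A] by blast
    also have "card ?R = n - 2"
      using ne lt(2)[OF i] lt(2)[OF moved] by (subst card_Diff_subset) auto
    finally show False
      using reflection_eigenvalue_mult_one[OF refl] ne lt(2)[OF i] lt(2)[OF moved] by linarith
  qed
  have "f (f i) = i"
  proof (rule ccontr)
    assume "f (f i) \<noteq> i"
    moreover have ne: "f (f i) \<noteq> f i" using inj[of "f i" i] i by blast
    ultimately have "f (f (f i)) = f (f i)" by (rule fixed)
    then show False using inj[of "f (f i)" "f i"] ne by blast
  qed
  then have "f = transpose i (f i)"
    using fixed by (auto simp: transpose_def)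
  then show ?thesis using that lt[OF i] by blast
qed

section \<open>The group generated by the reflections\<close>

lemma carrier_GL: "A \<in> carrier (GL n) \<Longrightarrow> A \<in> carrier_mat n n"
  by (auto simp: GL_def units_of_def Units_def ring_mat_simps)

lemma mult_GL [simp]: "A \<otimes>\<^bsub>GL n\<^esub> B = A * B"
  by (simp add: GL_def units_of_def ring_mat_simps)

lemma one_GL [simp]: "\<one>\<^bsub>GL n\<^esub> = 1\<^sub>m n"
  by (simp add: GL_def units_of_def ring_mat_simps)

lemma group_GL: "group (GL n)"
proof -
  interpret ring "ring_mat TYPE(complex) n ()" by (rule ring_mat)
  show ?thesis unfolding GL_def by (rule units_group)
qed

lemma pow_GL: "A [^]\<^bsub>GL n\<^esub> (k :: nat) = A ^\<^sub>m k" if "A \<in> carrier (GL n)"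
  using carrier_GL[OF that] by (induction k) auto

lemma finite_mats_with_entries:
  assumes "finite S"
  shows "finite {A \<in> carrier_mat m n. \<forall>i<m. \<forall>j<n. A $$ (i, j) \<in> S}"
proof (rule finite_subset)
  show "{A \<in> carrier_mat m n. \<forall>i<m. \<forall>j<n. A $$ (i, j) \<in> S}
    \<subseteq> mat m n ` (({..<m} \<times> {..<n}) \<rightarrow>\<^sub>E S)"
  proof
    fix A assume A: "A \<in> {A \<in> carrier_mat m n. \<forall>i<m. \<forall>j<n. A $$ (i, j) \<in> S}"
    let ?f = "restrict (($$) A) ({..<m} \<times> {..<n})"
    have "A = mat m n ?f" using A by (intro eq_matI) auto
    moreover have "?f \<in> ({..<m} \<times> {..<n}) \<rightarrow>\<^sub>E S" using A by auto
    ultimately show "A \<in> mat m n ` (({..<m} \<times> {..<n}) \<rightarrow>\<^sub>E S)" by blast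
  qed
  show "finite (mat m n ` (({..<m} \<times> {..<n}) \<rightarrow>\<^sub>E S))"
    using assms by (intro finite_imageI finite_PiE) auto
qed

text \<open>Finiteness gives the inverse of the product a finite order, as the multiplicity bound
  requires.\<close>

lemma finite_Gmpn:
  assumes "m \<ge> 1"
  shows "finite (Gmpn m p n)"
proof (rule finite_subset)
  let ?S = "insert 0 {z :: complex. z ^ m = 1}"
  show "Gmpn m p n \<subseteq> {A \<in> carrier_mat n n. \<forall>i<n. \<forall>j<n. A $$ (i, j) \<in> ?S}"
    by (auto simp: Gmpn_def generalized_permutation_mat_def)
  have "finite ?S" using finite_roots_unity[OF assms] by simp
  then show "finite {A \<in> carrier_mat n n. \<forall>i<n. \<forall>j<n. A $$ (i, j) \<in> ?S}"
    by (rule finite_mats_with_entries)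
qed

lemma (in group) subgroup_finite_order:
  assumes "subgroup H G" "finite H" "x \<in> H"
  shows "\<exists>N>0. x [^] (N :: nat) = \<one>"
proof -
  interpret H: group "G\<lparr>carrier := H\<rparr>" using assms(1) by (rule subgroup_imp_group)
  have "x [^]\<^bsub>G\<lparr>carrier := H\<rparr>\<^esub> Coset.order (G\<lparr>carrier := H\<rparr>) = \<one>"
    using H.pow_order_eq_1[of x] assms(3) by simp
  moreover have "Coset.order (G\<lparr>carrier := H\<rparr>) > 0"
    using assms by (auto simp: Coset.order_def card_gt_0_iff)
  ultimately show ?thesis by (metis nat_pow_consistent)
qed

section \<open>Connectedness through permutation matrices and projections\<close>

definition swap_mat :: "nat \<Rightarrow> nat \<Rightarrow> nat \<Rightarrow> complex mat" where
  "swap_mat n a b = mat n n (\<lambda>(i, j). if j = transpose a b i then 1 else 0)"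

text \<open>All nonzero entries are 1, so the root conditions hold whatever \<open>m\<close> and
  \<open>p\<close> are. These elements show that the group links any two indices.\<close>

lemma swap_mat_in_Gmpn:
  assumes "a < n" "b < n"
  shows "swap_mat n a b \<in> Gmpn m p n"
proof -
  have lt: "transpose a b i < n" if "i < n" for i
    using that assms by (auto simp: transpose_def)
  have nz: "swap_mat n a b $$ (i, j) = (if j = transpose a b i then 1 else 0)" if "i < n" "j < n" for i j
    using that by (simp add: swap_mat_def)
  have iff: "swap_mat n a b $$ (i, j) \<noteq> 0 \<longleftrightarrow> j = transpose a b i"
    and iff': "j = transpose a b i \<longleftrightarrow> i = transpose a b j" if "i < n" "j < n" for i j
    using nz[OF that] by (auto split: if_splits)
  have "\<exists>!j. j < n \<and> swap_mat n a b $$ (i, j) \<noteq> 0" if "i < n" for i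
    using lt[OF that] iff[OF that] by blast
  moreover have "\<exists>!i. i < n \<and> swap_mat n a b $$ (i, j) \<noteq> 0" if "j < n" for j
    using lt[OF that] iff[OF _ that] iff'[OF _ that] by blast
  moreover have "(\<Prod>(i, j)\<in>{(i, j). i < n \<and> j < n \<and> swap_mat n a b $$ (i, j) \<noteq> 0}.
      swap_mat n a b $$ (i, j)) = 1"
    by (rule prod.neutral) (auto simp: nz split: if_splits)
  ultimately show ?thesis
    by (auto simp: Gmpn_def generalized_permutation_mat_def nz) (auto simp: swap_mat_def)
qed

text \<open>Commuting with this projection says in one matrix identity that the coordinate subspaces
  of \<open>K\<close> and of its complement are stable; such an identity passes to products and
  inverses.\<close>

definition coord_proj :: "nat \<Rightarrow> nat set \<Rightarrow> complex mat" where
  "coord_proj n K = mat n n (\<lambda>(i, j). if i = j \<and> i \<in> K then 1 else 0)"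

lemma coord_proj_carrier [simp]: "coord_proj n K \<in> carrier_mat n n"
  by (simp add: coord_proj_def)

lemma dim_coord_proj [simp]: "dim_row (coord_proj n K) = n" "dim_col (coord_proj n K) = n"
  by (simp_all add: coord_proj_def)

text \<open>Multiplication on the right erases the columns outside \<open>K\<close>, on the left the
  rows outside \<open>K\<close>.\<close>

lemma coord_proj_commute_iff:
  assumes A: "A \<in> carrier_mat n n"
  shows "A * coord_proj n K = coord_proj n K * A \<longleftrightarrow>
    (\<forall>i<n. \<forall>j<n. A $$ (i, j) \<noteq> 0 \<longrightarrow> (i \<in> K \<longleftrightarrow> j \<in> K))"
proof -
  have l: "(A * coord_proj n K) $$ (i, j) = (if j \<in> K then A $$ (i, j) else 0)"
    if "i < n" "j < n" for i j
  proof -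
    have "(A * coord_proj n K) $$ (i, j) =
        (\<Sum>k\<in>{0..<n}. A $$ (i, k) * (if k = j \<and> k \<in> K then 1 else 0))"
      using A that by (simp add: scalar_prod_def coord_proj_def)
    also have "\<dots> = (\<Sum>k\<in>{0..<n}. if k = j then (if j \<in> K then A $$ (i, j) else 0) else 0)"
      by (rule sum.cong) auto
    finally show ?thesis using that by simp
  qed
  have r: "(coord_proj n K * A) $$ (i, j) = (if i \<in> K then A $$ (i, j) else 0)"
    if "i < n" "j < n" for i j
  proof -
    have "(coord_proj n K * A) $$ (i, j) =
        (\<Sum>k\<in>{0..<n}. (if i = k \<and> i \<in> K then 1 else 0) * A $$ (k, j))"
      using A that by (simp add: scalar_prod_def coord_proj_def)
    also have "\<dots> = (\<Sum>k\<in>{0..<n}. if k = i then (if i \<in> K then A $$ (i, j) else 0) else 0)"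
      by (rule sum.cong) auto
    finally show ?thesis using that by simp
  qed
  have "A * coord_proj n K = coord_proj n K * A \<longleftrightarrow>
    (\<forall>i<n. \<forall>j<n. (A * coord_proj n K) $$ (i, j) = (coord_proj n K * A) $$ (i, j))"
    using A by (subst mat_eq_iff) (auto simp del: index_mult_mat(1))
  also have "\<dots> \<longleftrightarrow> (\<forall>i<n. \<forall>j<n. A $$ (i, j) \<noteq> 0 \<longrightarrow> (i \<in> K \<longleftrightarrow> j \<in> K))"
    by (auto simp: l r)
  finally show ?thesis .
qed

text \<open>\<open>E\<close> may be singular and so lie outside \<open>GL n\<close>; closure of the
  commutant is therefore checked by matrix identities.\<close>

lemma generate_GL_commute:
  assumes H: "H \<subseteq> carrier (GL n)" and x: "x \<in> generate (GL n) H"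
    and E: "E \<in> carrier_mat n n" and comm: "\<And>A. A \<in> H \<Longrightarrow> A * E = E * A"
  shows "x * E = E * x"
proof -
  interpret group "GL n" by (rule group_GL)
  have inv_commute: "inv\<^bsub>GL n\<^esub> A * E = E * inv\<^bsub>GL n\<^esub> A" if "A \<in> H" for A
  proof -
    let ?B = "inv\<^bsub>GL n\<^esub> A"
    have B: "A \<in> carrier_mat n n" "?B \<in> carrier_mat n n" "A * ?B = 1\<^sub>m n" "?B * A = 1\<^sub>m n"
      using that H carrier_GL r_inv[of A] l_inv[of A] inv_closed[of A] by auto
    have "?B * E = ?B * (E * (A * ?B))" using B E by simp
    also have "\<dots> = ?B * (E * A) * ?B"
      using B(1,2) E by (simp add: assoc_mult_mat[of _ n n _ n _ n])
    also have "\<dots> = ?B * A * E * ?B"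
      using B(1,2) E comm[OF that, symmetric] by (simp add: assoc_mult_mat[of _ n n _ n _ n])
    finally show ?thesis using B E by simp
  qed
  have "x \<in> carrier (GL n) \<and> x * E = E * x" using x
  proof induction
    case one
    then show ?case using E one_closed by simp
  next
    case (incl h)
    then show ?case using H comm by auto
  next
    case (inv h)
    then show ?case using H inv_commute by auto
  next
    case (eng h1 h2)
    then have c: "h1 \<in> carrier_mat n n" "h2 \<in> carrier_mat n n" using carrier_GL by auto
    have "h1 * h2 * E = h1 * (E * h2)"
      using c E eng.IH assoc_mult_mat[of h1 n n h2 n E n] by simp
    also have "\<dots> = E * h1 * h2"
      using c E eng.IH assoc_mult_mat[of h1 n n E n h2 n] by simp
    also have "\<dots> = E * (h1 * h2)"
      by (rule assoc_mult_mat[OF E c])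
    finally show ?case using eng.IH m_closed[of h1 h2] by simp
  qed
  then show ?thesis ..
qed

text \<open>Reading permutations along rows makes the leftmost factor act first, which is the order
  of composition in \<open>prod_transpose\<close>.\<close>

lemma monomial_mat_foldr:
  fixes As :: "'a :: {semiring_no_zero_divisors, semiring_1} mat list"
  assumes "list_all2 (\<lambda>A (a, b). monomial_mat n A (transpose a b)) As xs"
  shows "monomial_mat n (foldr (*) As (1\<^sub>m n)) (prod_transpose xs)"
  using assms
proof (induction rule: list_all2_induct)
  case Nil
  then show ?case using monomial_mat_one[of n] by (simp add: id_def)
next
  case (Cons A As x xs)
  obtain a b where "x = (a, b)" by force
  then show ?case
    using monomial_mat_mult[of n A "transpose a b"] Cons by (simp del: o_apply add: comp_def)
qed

theorem theorem1p4:
  fixes m p n :: nat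
  assumes "m \<ge> 1" and "p \<ge> 1" and "n \<ge> 5" and "p dvd m"
  shows "\<not> (\<exists>As. length As = n \<and> nice_tuple n (Gmpn m p n) As)"
proof
  assume "\<exists>As. length As = n \<and> nice_tuple n (Gmpn m p n) As"
  then obtain As z where len: "length As = n"
    and As: "\<And>A. A \<in> set As \<Longrightarrow> A \<in> Gmpn m p n \<and> is_reflection n A"
    and gen: "Gmpn m p n = generate (GL n) (set As)"
    and mult: "eigenvalue_mult (inv\<^bsub>GL n\<^esub> (foldr (*) As (1\<^sub>m n))) z + 2 = n"
    by (auto simp: nice_tuple_def)
  interpret group "GL n" by (rule group_GL)
  have carr: "set As \<subseteq> carrier (GL n)" using As by (auto simp: is_reflection_def)
  have sub: "subgroup (Gmpn m p n) (GL n)" unfolding gen using carr by (rule generate_is_subgroup)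
  have "\<exists>x. fst x < n \<and> snd x < n \<and> monomial_mat n A (transpose (fst x) (snd x))"
    if "A \<in> set As" for A
  proof -
    have "generalized_permutation_mat n A" using As[OF that] by (simp add: Gmpn_def)
    then obtain f where f: "monomial_mat n A f" by (rule generalized_permutation_mat_monomial)
    moreover have "is_reflection n A" using As[OF that] by blast
    ultimately obtain a b where "a < n" "b < n" "f = transpose a b"
      by (rule reflection_monomial_mat_transpose)
    then show ?thesis using f by (intro exI[of _ "(a, b)"]) simp
  qed
  then obtain edge where edge: "\<And>A. A \<in> set As \<Longrightarrow> fst (edge A) < n \<and> snd (edge A) < n
      \<and> monomial_mat n A (transpose (fst (edge A)) (snd (edge A)))"
    by metis
  define xs where "xs = map edge As"
  have xs: "set xs \<subseteq> {..<n} \<times> {..<n}" "length xs = n"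
    unfolding xs_def set_map image_subset_iff mem_Times_iff using edge len by simp_all
  define P where "P = foldr (*) As (1\<^sub>m n)"
  have P: "monomial_mat n P (prod_transpose xs)" unfolding P_def
    by (rule monomial_mat_foldr) (use edge in \<open>simp add: xs_def list_all2_map2 list_all2_same case_prod_beta\<close>)
  have "foldr (*) Bs (1\<^sub>m n) \<in> Gmpn m p n" if "set Bs \<subseteq> set As" for Bs
    using that subgroup.m_closed[OF sub] subgroup.one_closed[OF sub] As by (induction Bs) auto
  then have PW: "P \<in> Gmpn m p n" by (simp add: P_def)
  then have Pc: "P \<in> carrier (GL n)" using subgroup.subset[OF sub] by blast
  let ?Q = "inv\<^bsub>GL n\<^esub> P"
  have Q: "?Q \<in> Gmpn m p n" "P * ?Q = 1\<^sub>m n" "?Q \<in> carrier (GL n)"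
    using subgroup.m_inv_closed[OF sub PW] r_inv[OF Pc] Pc by auto
  obtain N where N: "N > 0" "?Q ^\<^sub>m N = 1\<^sub>m n"
    using subgroup_finite_order[OF sub finite_Gmpn[OF assms(1)] Q(1)] pow_GL[OF Q(3)] by auto

  \<comment> \<open>\<open>K\<close> is the component of \<open>0\<close>. Every edge has both or
    neither of its ends in \<open>K\<close>, so all generators, and with them the whole group,
    commute with the projection to \<open>K\<close>.\<close>
  define K where "K = {i. (0, i) \<in> edge_rel xs}"
  have "(0, j) \<in> edge_rel xs" if "j < n" for j
  proof -
    have "A * coord_proj n K = coord_proj n K * A" if A: "A \<in> set As" for A
    proof -
      obtain a b where ab: "edge A = (a, b)" by force
      have "(a, b) \<in> set xs" using A ab by (force simp: xs_def)
      then have rel: "(a, b) \<in> edge_rel xs" unfolding edge_rel_def by blast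
      then have "(b, a) \<in> edge_rel xs" by (rule symD[OF edge_rel_equiv(1)])
      with rel have "a \<in> K \<longleftrightarrow> b \<in> K"
        using transD[OF edge_rel_equiv(2), of 0 a xs b] transD[OF edge_rel_equiv(2), of 0 b xs a]
        by (auto simp: K_def)
      then have K: "i \<in> K \<longleftrightarrow> transpose a b i \<in> K" for i by (auto simp: transpose_def)
      have "A \<in> carrier_mat n n" using A carr carrier_GL by blast
      moreover have "monomial_mat n A (transpose a b)" using edge[OF A] ab by simp
      ultimately show ?thesis using K unfolding coord_proj_commute_iff[OF \<open>A \<in> carrier_mat n n\<close>]
        by (simp add: monomial_mat_def)
    qed
    \<comment> \<open>This group element has a nonzero entry at \<open>(0, j)\<close>, so commuting
      with the projection forces \<open>j\<close> into \<open>K\<close>.\<close>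
    moreover have swap: "swap_mat n 0 j \<in> generate (GL n) (set As)"
      using swap_mat_in_Gmpn[of 0 n j] that assms(3) gen by auto
    ultimately have "swap_mat n 0 j * coord_proj n K = coord_proj n K * swap_mat n 0 j"
      using generate_GL_commute[OF carr] by auto
    moreover have "swap_mat n 0 j $$ (0, j) \<noteq> 0" using that assms(3) by (simp add: swap_mat_def)
    ultimately have "0 \<in> K \<longleftrightarrow> j \<in> K"
      using that assms(3) by (subst (asm) coord_proj_commute_iff) (auto simp: swap_mat_def)
    then show ?thesis by (simp add: K_def edge_rel_equiv)
  qed
  \<comment> \<open>One component, represented by \<open>0\<close>, and \<open>n\<close> factors:
    the bound leaves at most two representatives.\<close>
  then obtain R where R: "hits {..<n} (prod_transpose xs) R" "card R + n \<le> 2 + n"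
    using prod_transpose_hits[of "{..<n}" xs "{0}"] xs assms(3) by auto
  \<comment> \<open>The multiplicity is at most 2, whereas niceness makes it \<open>n - 2\<close>,
    at least 3.\<close>
  have "eigenvalue_mult ?Q z \<le> card R"
    using inverse_monomial_mat_eigenvalue_mult_le[OF P carrier_GL[OF Q(3)] Q(2) N(2,1) R(1)] .
  with R(2) mult assms(3) show False by (simp add: P_def)
qed

end
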